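(* Let $\mathcal L\in\{\mathbf{nbIciw},\mathbf{nbIci},\mathbf{nbIcl}\}$. For every set of formulas $\Gamma\cup\{\varphi\}\subseteq \mathbf{F}(\Sigma_{\mathbf{nbI}},\mathcal V)$: if $\Gamma\vDash_{\mathcal L}\varphi$ then $\Gamma\vdash_{\mathcal L}\varphi$.
   Context: Let $\mathcal V$ be a countable set of propositional variables and $\Sigma_{\mathbf{nbI}}=\{\vee,\wedge,\rightarrow,\uparrow,\neg\}$ with $\neg$ unary and the other connectives binary; $\mathbf F(\Sigma_{\mathbf{nbI}},\mathcal V)$ is the set of formulas. The logic $\mathbf{nbI}$ is the Hilbert calculus whose only inference rule is Modus Ponens and whose axioms are all instances (with arbitrary formulas) of: (1) $\alpha\to(\beta\to\alpha)$; (2) $(\alpha\to(\beta\to\gamma))\to((\alpha\to\beta)\to(\alpha\to\gamma))$; (3) $\alpha\to(\beta\to(\alpha\wedge\beta))$; (4) $(\alpha\wedge\beta)\to\alpha$; (5) $(\alpha\wedge\beta)\to\beta$; (6) $\alpha\to(\alpha\vee\beta)$; (7) $\beta\to(\alpha\vee\beta)$; (8) $(\alpha\to\gamma)\to((\beta\to\gamma)\to((\alpha\vee\beta)\to\gamma))$; (9) $(\alpha\to\beta)\vee\alpha$; (Ip) $(\alpha\uparrow\beta)\to(\alpha\to(\beta\to\gamma))$; (Comm) $(\alpha\uparrow\beta)\to(\beta\uparrow\alpha)$; (11) $\alpha\vee\neg\alpha$. The logics $\mathbf{nbIciw}$, $\mathbf{nbIci}$, $\mathbf{nbIcl}$ are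 obtained from $\mathbf{nbI}$ by adding, respectively, all instances of $(\alpha\uparrow\neg\alpha)\vee(\alpha\wedge\neg\alpha)$; of $\neg(\alpha\uparrow\neg\alpha)\to(\alpha\wedge\neg\alpha)$; of $\neg(\alpha\wedge\neg\alpha)\to(\alpha\uparrow\neg\alpha)$. $\Gamma\vdash_{\mathcal L}\varphi$ means that there is a finite derivation of $\varphi$ from premises in $\Gamma$ in the calculus of $\mathcal L$. A bivaluation for $\mathbf{nbI}$ is a map $\nu:\mathbf F(\Sigma_{\mathbf{nbI}},\mathcal V)\to\{0,1\}$ such that for all formulas $\alpha,\beta$: $\nu(\alpha\vee\beta)=1$ iff $\nu(\alpha)=1$ or $\nu(\beta)=1$; $\nu(\alpha\wedge\beta)=1$ iff $\nu(\alpha)=\nu(\beta)=1$; $\nu(\alpha\to\beta)=1$ iff $\nu(\alpha)=0$ or $\nu(\beta)=1$; if $\nu(\alpha\uparrow\beta)=1$ then $\nu(\alpha)=0$ or $\nu(\beta)=0$; $\nu(\alpha\uparrow\beta)=\nu(\beta\uparrow\alpha)$; if $\nu(\neg\alpha)=0$ then $\nu(\alpha)=1$. A bivaluation for $\mathcal L$ is a bivaluation $\nu$ for $\mathbf{nbI}$ such that for all $\alpha$: if $\nu(\alpha\uparrow\neg\alpha)=0$ then $\nu(\alpha)=\nu(\neg\alpha)=1$; if $\mathcal L=\mathbf{nbIci}$, moreover, $\nu(\neg(\alpha\uparrow\neg\alpha))=1$ implies $\nu(\alpha)=\nu(\neg\alpha)=1$; if $\mathcal L=\mathbf{nbIcl}$,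 moreover, $\nu(\neg(\alpha\wedge\neg\alpha))=1$ implies $\nu(\alpha\uparrow\neg\alpha)=1$. $\Gamma\vDash_{\mathcal L}\varphi$ means: for every bivaluation $\nu$ for $\mathcal L$, if $\nu(\gamma)=1$ for all $\gamma\in\Gamma$ then $\nu(\varphi)=1$. *)

theory Defs
  imports "HOL-Library.Countable"
begin

datatype 'v fm =
    Var 'v
  | Disj "'v fm" "'v fm"  (infixr \<open>\<^bold>\<or>\<close> 60)
  | Conj "'v fm" "'v fm"  (infixr \<open>\<^bold>\<and>\<close> 65)
  | Impl "'v fm" "'v fm"  (infixr \<open>\<^bold>\<rightarrow>\<close> 55)
  | Incomp "'v fm" "'v fm"  (infix \<open>\<^bold>\<up>\<close> 70)
  | Neg "'v fm"  (\<open>\<^bold>\<not> _\<close> [80] 80)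

inductive nbI_axiom :: "'v fm \<Rightarrow> bool" where
  Ax1: "nbI_axiom (\<alpha> \<^bold>\<rightarrow> (\<beta> \<^bold>\<rightarrow> \<alpha>))"
| Ax2: "nbI_axiom ((\<alpha> \<^bold>\<rightarrow> (\<beta> \<^bold>\<rightarrow> \<gamma>)) \<^bold>\<rightarrow> ((\<alpha> \<^bold>\<rightarrow> \<beta>) \<^bold>\<rightarrow> (\<alpha> \<^bold>\<rightarrow> \<gamma>)))"
| Ax3: "nbI_axiom (\<alpha> \<^bold>\<rightarrow> (\<beta> \<^bold>\<rightarrow> (\<alpha> \<^bold>\<and> \<beta>)))"
| Ax4: "nbI_axiom ((\<alpha> \<^bold>\<and> \<beta>) \<^bold>\<rightarrow> \<alpha>)"
| Ax5: "nbI_axiom ((\<alpha> \<^bold>\<and> \<beta>) \<^bold>\<rightarrow> \<beta>)"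
| Ax6: "nbI_axiom (\<alpha> \<^bold>\<rightarrow> (\<alpha> \<^bold>\<or> \<beta>))"
| Ax7: "nbI_axiom (\<beta> \<^bold>\<rightarrow> (\<alpha> \<^bold>\<or> \<beta>))"
| Ax8: "nbI_axiom ((\<alpha> \<^bold>\<rightarrow> \<gamma>) \<^bold>\<rightarrow> ((\<beta> \<^bold>\<rightarrow> \<gamma>) \<^bold>\<rightarrow> ((\<alpha> \<^bold>\<or> \<beta>) \<^bold>\<rightarrow> \<gamma>)))"
| Ax9: "nbI_axiom ((\<alpha> \<^bold>\<rightarrow> \<beta>) \<^bold>\<or> \<alpha>)"
| Ip: "nbI_axiom ((\<alpha> \<^bold>\<up> \<beta>) \<^bold>\<rightarrow> (\<alpha> \<^bold>\<rightarrow> (\<beta> \<^bold>\<rightarrow> \<gamma>)))"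
| Comm: "nbI_axiom ((\<alpha> \<^bold>\<up> \<beta>) \<^bold>\<rightarrow> (\<beta> \<^bold>\<up> \<alpha>))"
| Ax11: "nbI_axiom (\<alpha> \<^bold>\<or> \<^bold>\<not> \<alpha>)"

datatype nb_logic = nbI | nbIciw | nbIci | nbIcl

inductive axiom_of :: "nb_logic \<Rightarrow> 'v fm \<Rightarrow> bool" where
  base: "nbI_axiom \<phi> \<Longrightarrow> axiom_of L \<phi>"
| ciw: "axiom_of nbIciw ((\<alpha> \<^bold>\<up> \<^bold>\<not> \<alpha>) \<^bold>\<or> (\<alpha> \<^bold>\<and> \<^bold>\<not> \<alpha>))"
| ci: "axiom_of nbIci (\<^bold>\<not> (\<alpha> \<^bold>\<up> \<^bold>\<not> \<alpha>) \<^bold>\<rightarrow> (\<alpha> \<^bold>\<and> \<^bold>\<not> \<alpha>))"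
| cl: "axiom_of nbIcl (\<^bold>\<not> (\<alpha> \<^bold>\<and> \<^bold>\<not> \<alpha>) \<^bold>\<rightarrow> (\<alpha> \<^bold>\<up> \<^bold>\<not> \<alpha>))"

definition derivation :: "nb_logic \<Rightarrow> 'v fm set \<Rightarrow> 'v fm list \<Rightarrow> bool" where
  "derivation L \<Gamma> ds \<longleftrightarrow>
     (\<forall>i < length ds. axiom_of L (ds ! i) \<or> ds ! i \<in> \<Gamma> \<or>
        (\<exists>j < i. \<exists>k < i. ds ! k = (ds ! j \<^bold>\<rightarrow> ds ! i)))"

definition derives :: "'v fm set \<Rightarrow> nb_logic \<Rightarrow> 'v fm \<Rightarrow> bool"
    (\<open>_ \<turnstile>\<^bsub>_\<^esub> _\<close> [51, 0, 51] 50) where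
  "\<Gamma> \<turnstile>\<^bsub>L\<^esub> \<phi> \<longleftrightarrow> (\<exists>ds. ds \<noteq> [] \<and> derivation L \<Gamma> ds \<and> last ds = \<phi>)"

text \<open>Truth values \<open>1\<close> and \<open>0\<close> are \<^const>\<open>True\<close> and \<^const>\<open>False\<close>.\<close>

definition bivaluation_nbI :: "('v fm \<Rightarrow> bool) \<Rightarrow> bool" where
  "bivaluation_nbI \<nu> \<longleftrightarrow>
     (\<forall>\<alpha> \<beta>. \<nu> (\<alpha> \<^bold>\<or> \<beta>) \<longleftrightarrow> \<nu> \<alpha> \<or> \<nu> \<beta>) \<and>
     (\<forall>\<alpha> \<beta>. \<nu> (\<alpha> \<^bold>\<and> \<beta>) \<longleftrightarrow> \<nu> \<alpha> \<and> \<nu> \<beta>) \<and>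
     (\<forall>\<alpha> \<beta>. \<nu> (\<alpha> \<^bold>\<rightarrow> \<beta>) \<longleftrightarrow> \<not> \<nu> \<alpha> \<or> \<nu> \<beta>) \<and>
     (\<forall>\<alpha> \<beta>. \<nu> (\<alpha> \<^bold>\<up> \<beta>) \<longrightarrow> \<not> \<nu> \<alpha> \<or> \<not> \<nu> \<beta>) \<and>
     (\<forall>\<alpha> \<beta>. \<nu> (\<alpha> \<^bold>\<up> \<beta>) = \<nu> (\<beta> \<^bold>\<up> \<alpha>)) \<and>
     (\<forall>\<alpha>. \<not> \<nu> (\<^bold>\<not> \<alpha>) \<longrightarrow> \<nu> \<alpha>)"

definition bivaluation :: "nb_logic \<Rightarrow> ('v fm \<Rightarrow> bool) \<Rightarrow> bool" where
  "bivaluation L \<nu> \<longleftrightarrow>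
     bivaluation_nbI \<nu> \<and>
     (L \<in> {nbIciw, nbIci, nbIcl} \<longrightarrow> (\<forall>\<alpha>. \<not> \<nu> (\<alpha> \<^bold>\<up> \<^bold>\<not> \<alpha>) \<longrightarrow> \<nu> \<alpha> \<and> \<nu> (\<^bold>\<not> \<alpha>))) \<and>
     (L = nbIci \<longrightarrow> (\<forall>\<alpha>. \<nu> (\<^bold>\<not> (\<alpha> \<^bold>\<up> \<^bold>\<not> \<alpha>)) \<longrightarrow> \<nu> \<alpha> \<and> \<nu> (\<^bold>\<not> \<alpha>))) \<and>
     (L = nbIcl \<longrightarrow> (\<forall>\<alpha>. \<nu> (\<^bold>\<not> (\<alpha> \<^bold>\<and> \<^bold>\<not> \<alpha>)) \<longrightarrow> \<nu> (\<alpha> \<^bold>\<up> \<^bold>\<not> \<alpha>)))"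

definition entails :: "'v fm set \<Rightarrow> nb_logic \<Rightarrow> 'v fm \<Rightarrow> bool"
    (\<open>_ \<Turnstile>\<^bsub>_\<^esub> _\<close> [51, 0, 51] 50) where
  "\<Gamma> \<Turnstile>\<^bsub>L\<^esub> \<phi> \<longleftrightarrow> (\<forall>\<nu>. bivaluation L \<nu> \<longrightarrow> (\<forall>\<gamma> \<in> \<Gamma>. \<nu> \<gamma>) \<longrightarrow> \<nu> \<phi>)"

end

theory Submission
  imports Defs
begin

text \<open>
  Completeness is shown by contraposition. If \<open>\<phi>\<close> is not derivable from \<open>\<Gamma>\<close>, Zorn's lemma extends
  \<open>\<Gamma>\<close> to a set \<open>\<Delta>\<close> that is maximal among the sets not deriving \<open>\<phi>\<close> (such sets are closed under unions
  of chains because derivations are finite), and membership in \<open>\<Delta>\<close> turns out to be a bivaluation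
  that satisfies \<open>\<Gamma>\<close> and refutes \<open>\<phi>\<close>.

  The heart of the matter is that \<open>\<Delta>\<close> is prime. A formula outside \<open>\<Delta>\<close> derives \<open>\<phi>\<close> together with \<open>\<Delta>\<close>,
  so by the deduction theorem it implies \<open>\<phi>\<close> in \<open>\<Delta>\<close>; if both disjuncts of a member of \<open>\<Delta>\<close> were outside
  \<open>\<Delta>\<close>, then axiom \<open>Ax8\<close> would yield \<open>\<phi>\<close>. Given a prime, deductively closed set that omits \<open>\<phi>\<close>,
  each clause of a bivaluation is read off from axioms: the disjunctive axioms \<open>Ax9\<close>, \<open>Ax11\<close>
  and \<open>ciw\<close> force one of two formulas into \<open>\<Delta>\<close>, and \<open>Ip\<close> keeps an incompatible pair from
  belonging to \<open>\<Delta>\<close>. The clause relating \<open>\<alpha> \<^bold>\<up> \<^bold>\<not> \<alpha>\<close> to \<open>\<alpha> \<^bold>\<and> \<^bold>\<not> \<alpha>\<close> is shared by all three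
  systems since \<open>ciw\<close> is derivable in each of them: in \<open>nbIci\<close> and \<open>nbIcl\<close> it follows by excluded
  middle on \<open>\<alpha> \<^bold>\<up> \<^bold>\<not> \<alpha>\<close> and on \<open>\<alpha> \<^bold>\<and> \<^bold>\<not> \<alpha>\<close>, respectively.
\<close>

section \<open>Derivability as an inductive closure\<close>

text \<open>
  Derivability as a least closed set replaces induction over positions in a derivation by
  rule induction.
\<close>

inductive_set consequences :: "nb_logic \<Rightarrow> 'v fm set \<Rightarrow> 'v fm set"
  for L \<Gamma> where
  axiom: "axiom_of L \<psi> \<Longrightarrow> \<psi> \<in> consequences L \<Gamma>"
| premise: "\<psi> \<in> \<Gamma> \<Longrightarrow> \<psi> \<in> consequences L \<Gamma>"
| modus_ponens: "\<alpha> \<^bold>\<rightarrow> \<psi> \<in> consequences L \<Gamma> \<Longrightarrow> \<alpha> \<in> consequences L \<Gamma> \<Longrightarrow> \<psi> \<in> consequences L \<Gamma>"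

text \<open>
  The steps of \<open>es\<close> keep their justifications once the positions they refer to are shifted by the
  length of \<open>ds\<close>.
\<close>

lemma derivation_append:
  assumes "derivation L \<Gamma> ds" "derivation L \<Gamma> es"
  shows "derivation L \<Gamma> (ds @ es)"
  unfolding derivation_def
proof (intro allI impI)
  let ?n = "length ds"
  fix i assume i: "i < length (ds @ es)"
  show "axiom_of L ((ds @ es) ! i) \<or> (ds @ es) ! i \<in> \<Gamma> \<or>
        (\<exists>j<i. \<exists>k<i. (ds @ es) ! k = ((ds @ es) ! j \<^bold>\<rightarrow> (ds @ es) ! i))"
  proof (cases "i < ?n")
    case True
    have eq: "(ds @ es) ! j = ds ! j" if "j \<le> i" for j
      using that True by (simp add: nth_append)
    from assms(1) True consider "axiom_of L (ds ! i) \<or> ds ! i \<in> \<Gamma>"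
      | j k where "j < i" "k < i" "ds ! k = (ds ! j \<^bold>\<rightarrow> ds ! i)"
      unfolding derivation_def by blast
    then show ?thesis
    proof cases
      case 1
      then show ?thesis using eq[of i] by auto
    next
      case (2 j k)
      then have "(ds @ es) ! k = ((ds @ es) ! j \<^bold>\<rightarrow> (ds @ es) ! i)"
        by (simp add: eq)
      with 2 show ?thesis by blast
    qed
  next
    case False
    then have eq: "(ds @ es) ! i = es ! (i - ?n)" and lt: "i - ?n < length es"
      using i by (auto simp: nth_append)
    consider "axiom_of L (es ! (i - ?n)) \<or> es ! (i - ?n) \<in> \<Gamma>"
      | j k where "j < i - ?n" "k < i - ?n" "es ! k = (es ! j \<^bold>\<rightarrow> es ! (i - ?n))"
      using assms(2) lt unfolding derivation_def by blast
    then show ?thesis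
    proof cases
      case 1
      then show ?thesis using eq by auto
    next
      case 2
      have "?n + j < i" "?n + k < i" using 2 by auto
      moreover have "(ds @ es) ! (?n + k) = ((ds @ es) ! (?n + j) \<^bold>\<rightarrow> (ds @ es) ! i)"
        using 2 eq by simp
      ultimately show ?thesis by blast
    qed
  qed
qed

lemma derivation_snoc:
  assumes "derivation L \<Gamma> ds"
    and "axiom_of L \<psi> \<or> \<psi> \<in> \<Gamma> \<or> (\<exists>\<alpha> \<in> set ds. (\<alpha> \<^bold>\<rightarrow> \<psi>) \<in> set ds)"
  shows "derivation L \<Gamma> (ds @ [\<psi>])"
  unfolding derivation_def
proof (intro allI impI)
  fix i assume "i < length (ds @ [\<psi>])"
  then consider "i < length ds" | "i = length ds" by fastforce
  then show "axiom_of L ((ds @ [\<psi>]) ! i) \<or> (ds @ [\<psi>]) ! i \<in> \<Gamma> \<or>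
        (\<exists>j<i. \<exists>k<i. (ds @ [\<psi>]) ! k = ((ds @ [\<psi>]) ! j \<^bold>\<rightarrow> (ds @ [\<psi>]) ! i))"
  proof cases
    case 1
    have eq: "(ds @ [\<psi>]) ! j = ds ! j" if "j \<le> i" for j
      using that 1 by (simp add: nth_append)
    from assms(1) 1 consider "axiom_of L (ds ! i) \<or> ds ! i \<in> \<Gamma>"
      | j k where "j < i" "k < i" "ds ! k = (ds ! j \<^bold>\<rightarrow> ds ! i)"
      unfolding derivation_def by blast
    then show ?thesis
    proof cases
      case 1
      then show ?thesis using eq[of i] by auto
    next
      case (2 j k)
      then have "(ds @ [\<psi>]) ! k = ((ds @ [\<psi>]) ! j \<^bold>\<rightarrow> (ds @ [\<psi>]) ! i)"
        by (simp add: eq)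
      with 2 show ?thesis by blast
    qed
  next
    case 2
    then have last: "(ds @ [\<psi>]) ! i = \<psi>" by simp
    show ?thesis
    proof (cases "axiom_of L \<psi> \<or> \<psi> \<in> \<Gamma>")
      case True
      then show ?thesis using last by auto
    next
      case False
      then obtain \<alpha> where "\<alpha> \<in> set ds" "(\<alpha> \<^bold>\<rightarrow> \<psi>) \<in> set ds"
        using assms(2) by blast
      then obtain j k where jk: "j < i" "k < i" "ds ! j = \<alpha>" "ds ! k = (\<alpha> \<^bold>\<rightarrow> \<psi>)"
        using 2 by (metis in_set_conv_nth)
      then have "(ds @ [\<psi>]) ! k = ((ds @ [\<psi>]) ! j \<^bold>\<rightarrow> (ds @ [\<psi>]) ! i)"
        using 2 last by (simp add: nth_append)
      with jk show ?thesis by blast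
    qed
  qed
qed

lemma consequences_imp_derives:
  assumes "\<psi> \<in> consequences L \<Gamma>"
  shows "\<Gamma> \<turnstile>\<^bsub>L\<^esub> \<psi>"
  using assms
proof induction
  case (axiom \<psi>)
  then have "derivation L \<Gamma> [\<psi>]" by (simp add: derivation_def)
  then show ?case unfolding derives_def by (intro exI[of _ "[\<psi>]"]) simp
next
  case (premise \<psi>)
  then have "derivation L \<Gamma> [\<psi>]" by (simp add: derivation_def)
  then show ?case unfolding derives_def by (intro exI[of _ "[\<psi>]"]) simp
next
  case (modus_ponens \<alpha> \<psi>)
  obtain ds where ds: "ds \<noteq> []" "derivation L \<Gamma> ds" "last ds = (\<alpha> \<^bold>\<rightarrow> \<psi>)"
    using modus_ponens.IH(1) unfolding derives_def by blast
  obtain es where es: "es \<noteq> []" "derivation L \<Gamma> es" "last es = \<alpha>"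
    using modus_ponens.IH(2) unfolding derives_def by blast
  have "\<alpha> \<in> set (ds @ es)" "(\<alpha> \<^bold>\<rightarrow> \<psi>) \<in> set (ds @ es)"
    using ds es last_in_set by fastforce+
  then have "derivation L \<Gamma> ((ds @ es) @ [\<psi>])"
    using derivation_append[OF ds(2) es(2)] by (intro derivation_snoc) blast+
  then show ?case
    unfolding derives_def by (intro exI[of _ "(ds @ es) @ [\<psi>]"]) simp
qed

lemmas nbI_rule = consequences.axiom[OF axiom_of.base]

lemma consequences_mono:
  assumes "\<Gamma> \<subseteq> \<Delta>"
  shows "consequences L \<Gamma> \<subseteq> consequences L \<Delta>"
proof
  fix \<psi> assume "\<psi> \<in> consequences L \<Gamma>"
  then show "\<psi> \<in> consequences L \<Delta>"
    using assms by induction (auto intro: consequences.intros)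
qed

text \<open>
  A derivation uses finitely many premises, and finitely many members of a chain have a largest one.
\<close>

lemma consequences_Union_chain:
  assumes "\<psi> \<in> consequences L (\<Union>C)" and "C \<noteq> {}"
    and chain: "\<And>A B. A \<in> C \<Longrightarrow> B \<in> C \<Longrightarrow> A \<subseteq> B \<or> B \<subseteq> A"
  shows "\<exists>A\<in>C. \<psi> \<in> consequences L A"
  using assms(1)
proof induction
  case (axiom \<psi>)
  then show ?case using \<open>C \<noteq> {}\<close> consequences.axiom by blast
next
  case (premise \<psi>)
  then show ?case using consequences.premise by blast
next
  case (modus_ponens \<alpha> \<psi>)
  then obtain A B where "A \<in> C" "\<alpha> \<^bold>\<rightarrow> \<psi> \<in> consequences L A" "B \<in> C" "\<alpha> \<in> consequences L B"
    by blast
  then show ?case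
    using chain[of A B] consequences_mono[of A B L] consequences_mono[of B A L]
      consequences.modus_ponens by blast
qed

section \<open>The deduction theorem\<close>

lemma weaken:
  assumes "\<psi> \<in> consequences L \<Gamma>"
  shows "\<alpha> \<^bold>\<rightarrow> \<psi> \<in> consequences L \<Gamma>"
  by (rule consequences.modus_ponens[OF nbI_rule[OF Ax1] assms])

theorem deduction_theorem:
  assumes "\<psi> \<in> consequences L (insert \<alpha> \<Gamma>)"
  shows "\<alpha> \<^bold>\<rightarrow> \<psi> \<in> consequences L \<Gamma>"
  using assms
proof induction
  case (axiom \<psi>)
  then show ?case by (intro weaken consequences.axiom)
next
  case (premise \<psi>)
  show ?case
  proof (cases "\<psi> = \<alpha>")
    case True
    (* The formula \<open>\<alpha> \<^bold>\<rightarrow> \<alpha>\<close> is the combinator S K K. *)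
    have K: "\<alpha> \<^bold>\<rightarrow> (\<alpha> \<^bold>\<rightarrow> \<alpha>) \<in> consequences L \<Gamma>"
      and K': "\<alpha> \<^bold>\<rightarrow> ((\<alpha> \<^bold>\<rightarrow> \<alpha>) \<^bold>\<rightarrow> \<alpha>) \<in> consequences L \<Gamma>"
      by (rule nbI_rule[OF Ax1])+
    show ?thesis
      unfolding True
      by (rule consequences.modus_ponens[OF consequences.modus_ponens[OF nbI_rule[OF Ax2] K'] K])
  next
    case False
    then show ?thesis using premise by (auto intro: weaken consequences.premise)
  qed
next
  case (modus_ponens \<beta> \<psi>)
  show ?case
    by (rule consequences.modus_ponens[OF consequences.modus_ponens[OF nbI_rule[OF Ax2]]])
      (fact modus_ponens.IH)+
qed

section \<open>Maximal non-deriving sets\<close>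

lemma maximal_nonderiving_extension:
  assumes "\<phi> \<notin> consequences L \<Gamma>"
  obtains \<Delta> where "\<Gamma> \<subseteq> \<Delta>" "\<phi> \<notin> consequences L \<Delta>"
    "\<And>\<psi>. \<psi> \<notin> \<Delta> \<Longrightarrow> \<phi> \<in> consequences L (insert \<psi> \<Delta>)"
proof -
  let ?S = "{\<Delta>. \<Gamma> \<subseteq> \<Delta> \<and> \<phi> \<notin> consequences L \<Delta>}"
  have "\<exists>\<Delta>\<in>?S. \<forall>X\<in>?S. \<Delta> \<subseteq> X \<longrightarrow> X = \<Delta>"
  proof (rule subset_Zorn_nonempty)
    show "?S \<noteq> {}" using assms by blast
  next
    fix C assume C: "C \<noteq> {}" "subset.chain ?S C"
    then have "\<And>A B. A \<in> C \<Longrightarrow> B \<in> C \<Longrightarrow> A \<subseteq> B \<or> B \<subseteq> A" and "C \<subseteq> ?S"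
      by (auto simp: subset_chain_def)
    then show "\<Union>C \<in> ?S"
      using consequences_Union_chain[of \<phi> L C] C(1) by blast
  qed
  then obtain \<Delta> where \<Delta>: "\<Gamma> \<subseteq> \<Delta>" "\<phi> \<notin> consequences L \<Delta>"
    and max: "\<forall>X\<in>?S. \<Delta> \<subseteq> X \<longrightarrow> X = \<Delta>" by blast
  have "\<phi> \<in> consequences L (insert \<psi> \<Delta>)" if "\<psi> \<notin> \<Delta>" for \<psi>
    using \<Delta>(1) max that by blast
  with \<Delta> show thesis using that by blast
qed

locale maximal_nonderiving =
  fixes L :: nb_logic and \<phi> :: "'v fm" and \<Delta> :: "'v fm set"
  assumes omits: "\<phi> \<notin> consequences L \<Delta>"
    and maximal: "\<And>\<psi>. \<psi> \<notin> \<Delta> \<Longrightarrow> \<phi> \<in> consequences L (insert \<psi> \<Delta>)"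
begin

lemma implies_goal: "\<psi> \<notin> \<Delta> \<Longrightarrow> \<psi> \<^bold>\<rightarrow> \<phi> \<in> consequences L \<Delta>"
  by (intro deduction_theorem maximal)

text \<open>A consequence left out of \<open>\<Delta>\<close> would imply \<open>\<phi>\<close>, so that \<open>\<Delta>\<close> would derive \<open>\<phi>\<close>.\<close>

lemma closed: "\<psi> \<in> consequences L \<Delta> \<Longrightarrow> \<psi> \<in> \<Delta>"
  using implies_goal[of \<psi>] omits consequences.modus_ponens[of \<psi> \<phi> L \<Delta>] by blast

lemma axiom_mem: "axiom_of L \<psi> \<Longrightarrow> \<psi> \<in> \<Delta>"
  by (intro closed consequences.axiom)

lemmas nbI_axiom_mem = axiom_mem[OF axiom_of.base]

lemma mp_mem: "\<alpha> \<^bold>\<rightarrow> \<beta> \<in> \<Delta> \<Longrightarrow> \<alpha> \<in> \<Delta> \<Longrightarrow> \<beta> \<in> \<Delta>"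
  by (rule closed) (rule consequences.modus_ponens[OF consequences.premise consequences.premise])

lemma omits_goal: "\<phi> \<notin> \<Delta>"
  using omits consequences.premise by blast

text \<open>
  If neither disjunct belonged to \<open>\<Delta>\<close>, each would imply \<open>\<phi>\<close>, and reasoning by cases would
  derive \<open>\<phi>\<close>.
\<close>

lemma prime:
  assumes "\<alpha> \<^bold>\<or> \<beta> \<in> \<Delta>"
  shows "\<alpha> \<in> \<Delta> \<or> \<beta> \<in> \<Delta>"
proof (rule ccontr)
  assume "\<not> (\<alpha> \<in> \<Delta> \<or> \<beta> \<in> \<Delta>)"
  then have "\<alpha> \<^bold>\<rightarrow> \<phi> \<in> \<Delta>" "\<beta> \<^bold>\<rightarrow> \<phi> \<in> \<Delta>"
    by (simp_all add: implies_goal closed)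
  then have "\<phi> \<in> \<Delta>"
    by (rule mp_mem[OF mp_mem[OF mp_mem[OF nbI_axiom_mem[OF Ax8]]]]) (rule assms)
  then show False using omits_goal by contradiction
qed

lemma disj_mem: "\<alpha> \<^bold>\<or> \<beta> \<in> \<Delta> \<longleftrightarrow> \<alpha> \<in> \<Delta> \<or> \<beta> \<in> \<Delta>"
  using prime mp_mem[OF nbI_axiom_mem[OF Ax6]] mp_mem[OF nbI_axiom_mem[OF Ax7]] by blast

lemma conj_mem: "\<alpha> \<^bold>\<and> \<beta> \<in> \<Delta> \<longleftrightarrow> \<alpha> \<in> \<Delta> \<and> \<beta> \<in> \<Delta>"
  using mp_mem[OF mp_mem[OF nbI_axiom_mem[OF Ax3]]]
    mp_mem[OF nbI_axiom_mem[OF Ax4]] mp_mem[OF nbI_axiom_mem[OF Ax5]] by blast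

text \<open>
  If \<open>\<alpha>\<close> is outside \<open>\<Delta>\<close>, primeness applied to \<open>Ax9\<close> puts the implication inside; this is
  the half of the classical truth condition that positive intuitionistic logic would not give.
\<close>

lemma impl_mem: "\<alpha> \<^bold>\<rightarrow> \<beta> \<in> \<Delta> \<longleftrightarrow> \<alpha> \<notin> \<Delta> \<or> \<beta> \<in> \<Delta>"
  using mp_mem[of \<alpha> \<beta>] mp_mem[OF nbI_axiom_mem[OF Ax1]] prime[OF nbI_axiom_mem[OF Ax9]] by blast

lemma excluded_middle_mem: "\<alpha> \<in> \<Delta> \<or> \<^bold>\<not> \<alpha> \<in> \<Delta>"
  by (rule prime[OF nbI_axiom_mem[OF Ax11]])

text \<open>By \<open>Ip\<close>, an incompatible pair inside \<open>\<Delta>\<close> would explode and put \<open>\<phi>\<close> into \<open>\<Delta>\<close>.\<close>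

lemma incomp_mem: "\<alpha> \<^bold>\<up> \<beta> \<in> \<Delta> \<Longrightarrow> \<alpha> \<notin> \<Delta> \<or> \<beta> \<notin> \<Delta>"
  using mp_mem[OF mp_mem[OF mp_mem[OF nbI_axiom_mem[OF Ip]]]] omits_goal by blast

lemma incomp_commute_mem: "\<alpha> \<^bold>\<up> \<beta> \<in> \<Delta> \<longleftrightarrow> \<beta> \<^bold>\<up> \<alpha> \<in> \<Delta>"
  using mp_mem[OF nbI_axiom_mem[OF Comm]] by blast

section \<open>The canonical bivaluation\<close>

text \<open>
  The schema \<open>ciw\<close>, in semantic form. In \<open>nbIci\<close> and \<open>nbIcl\<close> it comes from excluded middle on the
  formula whose negation is the antecedent of the characteristic axiom.
\<close>

lemma incomp_neg_or_contradiction: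
  assumes "L \<in> {nbIciw, nbIci, nbIcl}"
  shows "\<alpha> \<^bold>\<up> \<^bold>\<not> \<alpha> \<in> \<Delta> \<or> (\<alpha> \<in> \<Delta> \<and> \<^bold>\<not> \<alpha> \<in> \<Delta>)"
proof -
  consider (ciw) "L = nbIciw" | (ci) "L = nbIci" | (cl) "L = nbIcl"
    using assms by blast
  then show ?thesis
  proof cases
    case ciw
    then have "(\<alpha> \<^bold>\<up> \<^bold>\<not> \<alpha>) \<^bold>\<or> (\<alpha> \<^bold>\<and> \<^bold>\<not> \<alpha>) \<in> \<Delta>"
      using axiom_mem axiom_of.ciw by blast
    then show ?thesis by (simp add: disj_mem conj_mem)
  next
    case ci
    then have "\<^bold>\<not> (\<alpha> \<^bold>\<up> \<^bold>\<not> \<alpha>) \<^bold>\<rightarrow> (\<alpha> \<^bold>\<and> \<^bold>\<not> \<alpha>) \<in> \<Delta>"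
      using axiom_mem axiom_of.ci by blast
    then show ?thesis
      using excluded_middle_mem[of "\<alpha> \<^bold>\<up> \<^bold>\<not> \<alpha>"] by (auto simp: impl_mem conj_mem)
  next
    case cl
    then have "\<^bold>\<not> (\<alpha> \<^bold>\<and> \<^bold>\<not> \<alpha>) \<^bold>\<rightarrow> (\<alpha> \<^bold>\<up> \<^bold>\<not> \<alpha>) \<in> \<Delta>"
      using axiom_mem axiom_of.cl by blast
    then show ?thesis
      using excluded_middle_mem[of "\<alpha> \<^bold>\<and> \<^bold>\<not> \<alpha>"] by (auto simp: impl_mem conj_mem)
  qed
qed

lemma bivaluation_mem: "bivaluation L (\<lambda>\<psi>. \<psi> \<in> \<Delta>)"
proof -
  have "bivaluation_nbI (\<lambda>\<psi>. \<psi> \<in> \<Delta>)"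
    unfolding bivaluation_nbI_def
    by (intro conjI allI impI disj_mem conj_mem impl_mem incomp_mem incomp_commute_mem)
      (use excluded_middle_mem in \<open>blast+\<close>)
  moreover have "\<alpha> \<in> \<Delta> \<and> \<^bold>\<not> \<alpha> \<in> \<Delta>" if "L = nbIci" "\<^bold>\<not> (\<alpha> \<^bold>\<up> \<^bold>\<not> \<alpha>) \<in> \<Delta>" for \<alpha>
    using that mp_mem[OF axiom_mem[of "\<^bold>\<not> (\<alpha> \<^bold>\<up> \<^bold>\<not> \<alpha>) \<^bold>\<rightarrow> (\<alpha> \<^bold>\<and> \<^bold>\<not> \<alpha>)"]]
    by (simp add: axiom_of.ci conj_mem)
  moreover have "\<alpha> \<^bold>\<up> \<^bold>\<not> \<alpha> \<in> \<Delta>" if "L = nbIcl" "\<^bold>\<not> (\<alpha> \<^bold>\<and> \<^bold>\<not> \<alpha>) \<in> \<Delta>" for \<alpha>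
    using that mp_mem[OF axiom_mem[of "\<^bold>\<not> (\<alpha> \<^bold>\<and> \<^bold>\<not> \<alpha>) \<^bold>\<rightarrow> (\<alpha> \<^bold>\<up> \<^bold>\<not> \<alpha>)"]]
    by (simp add: axiom_of.cl)
  ultimately show ?thesis
    unfolding bivaluation_def using incomp_neg_or_contradiction by (intro conjI allI impI) blast+
qed

end

section \<open>Completeness\<close>

theorem theorem10:
  fixes \<Gamma> :: "'v::countable fm set" and \<phi> :: "'v fm" and L :: nb_logic
  assumes "L \<in> {nbIciw, nbIci, nbIcl}"
    and "\<Gamma> \<Turnstile>\<^bsub>L\<^esub> \<phi>"
  shows "\<Gamma> \<turnstile>\<^bsub>L\<^esub> \<phi>"
proof (rule ccontr)
  assume "\<not> \<Gamma> \<turnstile>\<^bsub>L\<^esub> \<phi>"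
  then have "\<phi> \<notin> consequences L \<Gamma>"
    using consequences_imp_derives by blast
  then obtain \<Delta> where "\<Gamma> \<subseteq> \<Delta>" and max: "\<phi> \<notin> consequences L \<Delta>"
    "\<And>\<psi>. \<psi> \<notin> \<Delta> \<Longrightarrow> \<phi> \<in> consequences L (insert \<psi> \<Delta>)"
    by (erule maximal_nonderiving_extension)
  interpret maximal_nonderiving L \<phi> \<Delta>
    using max by unfold_locales
  show False
    using assms(2) bivaluation_mem \<open>\<Gamma> \<subseteq> \<Delta>\<close> omits_goal unfolding entails_def by blast
qed

end
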